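(* Let $K$ be a field, $S=K[x_1,\ldots,x_n]$ the polynomial ring with each $\deg x_i=1$, and let $I\subset S$ be a nonzero proper monomial ideal generated in one degree. Suppose that $I$ satisfies the $x$-condition (with respect to some monomial order $<^{\#}$ on $K[\{y_u\}_{u\in G(I)}]$). Then each power $I^k$, $k\ge1$, of $I$ has linear quotients.
   Context: $G(I)$ denotes the minimal system of monomial generators of $I$. The Rees algebra is $\mathcal R(I)=K[x_1,\ldots,x_n,\{ut\}_{u\in G(I)}]\subset S[t]$. Let $A=K[x_1,\ldots,x_n,\{y_u\}_{u\in G(I)}]$ be the polynomial ring in $n+|G(I)|$ variables, and let $J_{\mathcal R(I)}$ (the toric ideal of $\mathcal R(I)$) be the kernel of the surjective $K$-algebra homomorphism $\pi:A\to\mathcal R(I)$ with $\pi(x_i)=x_i$ and $\pi(y_u)=ut$. Let $<_{lex}$ be the lexicographic order on $S$ induced by $x_1>\cdots>x_n$, and fix an arbitrary monomial order $<^{\#}$ on $K[\{y_u\}_{u\in G(I)}]$. Define the monomial order $<^{\#}_{lex}$ on $A$ by: for monomials $x^a,x^b$ in the $x_i$ and $y^{a'},y^{b'}$ in the $y_u$, $x^ay^{a'}<^{\#}_{lex}x^by^{b'}$ if either (i) $y^{a'}<^{\#}y^{b'}$, or (ii) $y^{a'}=y^{b'}$ and $x^a<_{lex}x^b$. Then $I$ satisfies the $x$-condition (with respect to $<^{\#}$) if each element of the reduced Gröbner basis of $J_{\mathcal R(I)}$ with respect to $<^{\#}_{lex}$ is at most linear in the variables $x_1,\ldots,x_n$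 (i.e. every monomial occurring in it has total degree at most $1$ in $x_1,\ldots,x_n$). A sequence $f_1,\ldots,f_s$ of homogeneous elements of $S$ with $0<\deg f_1\le\cdots\le\deg f_s$ has linear quotients if for each $2\le j\le s$ the colon ideal $(f_1,\ldots,f_{j-1}):f_j$ is generated by linear forms. A graded ideal has linear quotients if it is generated by a sequence with linear quotients. *)

theory Defs
  imports "HOL-Library.Poly_Mapping" "HOL-Computational_Algebra.Polynomial"
begin

text \<open>
  A monomial in variables of type \<open>'v\<close> is an exponent vector \<open>'v \<Rightarrow>\<^sub>0 nat\<close>, and
  \<open>('v \<Rightarrow>\<^sub>0 nat) \<Rightarrow>\<^sub>0 'k\<close> is the polynomial ring over \<open>'k\<close> in these variables, with the
  convolution product of \<open>HOL-Library.Poly_Mapping\<close>. The ring \<open>S\<close> is the instance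
  \<open>'v = 'n :: {finite, linorder}\<close>; the least element of \<open>'n\<close> is the index of \<open>x\<^sub>1\<close>, the next
  one that of \<open>x\<^sub>2\<close>, and so on.
\<close>

type_synonym 'v monomial = "'v \<Rightarrow>\<^sub>0 nat"
type_synonym ('v, 'k) mpoly = "('v \<Rightarrow>\<^sub>0 nat) \<Rightarrow>\<^sub>0 'k"

abbreviation mon :: "'v monomial \<Rightarrow> ('v, 'k::comm_ring_1) mpoly" where
  "mon u \<equiv> Poly_Mapping.single u 1"

definition mdeg :: "'v monomial \<Rightarrow> nat" where
  "mdeg m = (\<Sum>v\<in>Poly_Mapping.keys m. Poly_Mapping.lookup m v)"

definition mons :: "'v set \<Rightarrow> 'v monomial set" where
  "mons V = {m. Poly_Mapping.keys m \<subseteq> V}"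

definition polys :: "'v set \<Rightarrow> ('v, 'k::comm_ring_1) mpoly set" where
  "polys V = {p. Poly_Mapping.keys p \<subseteq> mons V}"


section \<open>Ideals\<close>

text \<open>
  For \<open>B \<subseteq> polys V\<close>, the ideal of the subring \<open>polys V\<close> generated by \<open>B\<close>.
\<close>

definition ideal_gen :: "'v set \<Rightarrow> ('v, 'k::comm_ring_1) mpoly set \<Rightarrow> ('v, 'k) mpoly set" where
  "ideal_gen V B = {(\<Sum>b\<in>F. q b * b) | F q. finite F \<and> F \<subseteq> B \<and> q ` F \<subseteq> polys V}"

definition colon :: "('v, 'k::comm_ring_1) mpoly set \<Rightarrow> ('v, 'k) mpoly \<Rightarrow> ('v, 'k) mpoly set" where
  "colon J f = {h. h * f \<in> J}"

definition ideal_power :: "('v, 'k::comm_ring_1) mpoly set \<Rightarrow> nat \<Rightarrow> ('v, 'k) mpoly set" where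
  "ideal_power I k = ideal_gen UNIV {prod_list fs | fs. length fs = k \<and> set fs \<subseteq> I}"

text \<open>As usual, the zero polynomial is homogeneous of every degree.\<close>

definition homogeneous :: "nat \<Rightarrow> ('v, 'k::comm_ring_1) mpoly \<Rightarrow> bool" where
  "homogeneous d p \<longleftrightarrow> (\<forall>m\<in>Poly_Mapping.keys p. mdeg m = d)"

definition generated_in_one_degree :: "('v, 'k::comm_ring_1) mpoly set \<Rightarrow> bool" where
  "generated_in_one_degree I \<longleftrightarrow> (\<exists>d F. (\<forall>f\<in>F. homogeneous d f) \<and> I = ideal_gen UNIV F)"

definition monomial_ideal :: "('v, 'k::comm_ring_1) mpoly set \<Rightarrow> bool" where
  "monomial_ideal I \<longleftrightarrow> (\<exists>G. I = ideal_gen UNIV (mon ` G))"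

definition minimal_monomial_generators ::
    "('v, 'k::comm_ring_1) mpoly set \<Rightarrow> 'v monomial set \<Rightarrow> bool" where
  "minimal_monomial_generators I G \<longleftrightarrow>
     ideal_gen UNIV (mon ` G) = I \<and> (\<forall>G'. G' \<subset> G \<longrightarrow> ideal_gen UNIV (mon ` G') \<noteq> I)"

text \<open>
  \<open>G(I)\<close>; well defined for monomial ideals by \<open>ex1_minimal_monomial_generators\<close> below.
\<close>

definition min_gens :: "('v, 'k::comm_ring_1) mpoly set \<Rightarrow> 'v monomial set" where
  "min_gens I = (THE G. minimal_monomial_generators I G)"


section \<open>Linear quotients\<close>

text \<open>
  \<open>fs\<close> is the sequence \<open>f\<^sub>1, \<dots>, f\<^sub>s\<close>, indexed from \<open>0\<close>, and \<open>ds\<close> is the sequence of degrees.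
  A positive degree is only meaningful for nonzero polynomials, hence \<open>0 \<notin> set fs\<close>.
\<close>

definition linear_quotients_seq :: "('v, 'k::comm_ring_1) mpoly list \<Rightarrow> bool" where
  "linear_quotients_seq fs \<longleftrightarrow>
     0 \<notin> set fs \<and>
     (\<exists>ds. list_all2 homogeneous ds fs \<and> sorted ds \<and> (\<forall>d\<in>set ds. 0 < d)) \<and>
     (\<forall>j. 1 \<le> j \<and> j < length fs \<longrightarrow>
        (\<exists>L. (\<forall>l\<in>L. homogeneous 1 l) \<and>
             colon (ideal_gen UNIV (set (take j fs))) (fs ! j) = ideal_gen UNIV L))"

definition has_linear_quotients :: "('v, 'k::comm_ring_1) mpoly set \<Rightarrow> bool" where
  "has_linear_quotients I \<longleftrightarrow> (\<exists>fs. linear_quotients_seq fs \<and> I = ideal_gen UNIV (set fs))"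


section \<open>Monomial orders and Groebner bases\<close>

text \<open>
  Only the restriction of \<open>lt\<close> to the monomials in the variables from \<open>V\<close> matters.
\<close>

definition monomial_order :: "'v set \<Rightarrow> ('v monomial \<Rightarrow> 'v monomial \<Rightarrow> bool) \<Rightarrow> bool" where
  "monomial_order V lt \<longleftrightarrow>
     irreflp_on (mons V) lt \<and> transp_on (mons V) lt \<and> totalp_on (mons V) lt \<and>
     (\<forall>a\<in>mons V. a \<noteq> 0 \<longrightarrow> lt 0 a) \<and>
     (\<forall>a\<in>mons V. \<forall>b\<in>mons V. \<forall>c\<in>mons V. lt a b \<longrightarrow> lt (a + c) (b + c))"

definition init_mon ::
    "('v monomial \<Rightarrow> 'v monomial \<Rightarrow> bool) \<Rightarrow> ('v, 'k::comm_ring_1) mpoly \<Rightarrow> 'v monomial" where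
  "init_mon lt f =
     (THE m. m \<in> Poly_Mapping.keys f \<and> (\<forall>m'\<in>Poly_Mapping.keys f. m' \<noteq> m \<longrightarrow> lt m' m))"

definition init_ideal ::
    "'v set \<Rightarrow> ('v monomial \<Rightarrow> 'v monomial \<Rightarrow> bool) \<Rightarrow> ('v, 'k::comm_ring_1) mpoly set \<Rightarrow>
     ('v, 'k) mpoly set" where
  "init_ideal V lt J = ideal_gen V {mon (init_mon lt f) | f. f \<in> J \<and> f \<noteq> 0}"

definition groebner_basis ::
    "'v set \<Rightarrow> ('v monomial \<Rightarrow> 'v monomial \<Rightarrow> bool) \<Rightarrow> ('v, 'k::comm_ring_1) mpoly set \<Rightarrow>
     ('v, 'k) mpoly set \<Rightarrow> bool" where
  "groebner_basis V lt J B \<longleftrightarrow>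
     finite B \<and> B \<subseteq> J - {0} \<and> ideal_gen V ((\<lambda>g. mon (init_mon lt g)) ` B) = init_ideal V lt J"

text \<open>Divisibility of monomials is written additively, on exponent vectors.\<close>

definition reduced_groebner_basis ::
    "'v set \<Rightarrow> ('v monomial \<Rightarrow> 'v monomial \<Rightarrow> bool) \<Rightarrow> ('v, 'k::comm_ring_1) mpoly set \<Rightarrow>
     ('v, 'k) mpoly set \<Rightarrow> bool" where
  "reduced_groebner_basis V lt J B \<longleftrightarrow>
     groebner_basis V lt J B \<and>
     (\<forall>g\<in>B. Poly_Mapping.lookup g (init_mon lt g) = 1) \<and>
     (\<forall>g\<in>B. \<forall>h\<in>B. g \<noteq> h \<longrightarrow>
        (\<forall>m\<in>Poly_Mapping.keys h. \<not> (\<exists>c. m = init_mon lt g + c)))"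


section \<open>The toric ideal of the Rees algebra and the x-condition\<close>

text \<open>
  The variables of \<open>A\<close> are \<open>Inl i\<close>, standing for \<open>x\<^sub>i\<close>, and \<open>Inr u\<close> with \<open>u \<in> G(I)\<close>, standing
  for \<open>y\<^sub>u\<close>. Thus \<open>A\<close> is the subring \<open>polys (rees_vars I)\<close>.
\<close>

definition rees_vars :: "('n, 'k::comm_ring_1) mpoly set \<Rightarrow> ('n + 'n monomial) set" where
  "rees_vars I = UNIV <+> min_gens I"

definition eval_mpoly ::
    "('k \<Rightarrow> 'r) \<Rightarrow> ('v \<Rightarrow> 'r) \<Rightarrow> ('v, 'k::comm_ring_1) mpoly \<Rightarrow> 'r::comm_ring_1" where
  "eval_mpoly c \<phi> p =
     (\<Sum>m\<in>Poly_Mapping.keys p. c (Poly_Mapping.lookup p m) *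
        (\<Prod>v\<in>Poly_Mapping.keys m. \<phi> v ^ Poly_Mapping.lookup m v))"

text \<open>
  The \<open>K\<close>-algebra homomorphism \<open>\<pi>\<close> into \<open>S[t]\<close>, given by \<open>x\<^sub>i \<mapsto> x\<^sub>i\<close> and \<open>y\<^sub>u \<mapsto> u t\<close>. The Rees
  algebra is its image \<open>rees_map ` polys (rees_vars I)\<close>; restricting the codomain to the image
  does not change the kernel.
\<close>

definition rees_map :: "('n + 'n monomial, 'k::comm_ring_1) mpoly \<Rightarrow> ('n, 'k) mpoly poly" where
  "rees_map = eval_mpoly (\<lambda>a. [:Poly_Mapping.single 0 a:])
     (case_sum (\<lambda>i. [:mon (Poly_Mapping.single i 1):]) (\<lambda>u. monom (mon u) 1))"

definition rees_toric_ideal ::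
    "('n, 'k::comm_ring_1) mpoly set \<Rightarrow> ('n + 'n monomial, 'k) mpoly set" where
  "rees_toric_ideal I = {p \<in> polys (rees_vars I). rees_map p = 0}"

definition x_part :: "('n + 'n monomial) monomial \<Rightarrow> 'n monomial" where
  "x_part m = Poly_Mapping.map_key Inl m"

definition y_part :: "('n + 'n monomial) monomial \<Rightarrow> 'n monomial monomial" where
  "y_part m = Poly_Mapping.map_key Inr m"

text \<open>
  The order \<open><\<close> on \<open>'n monomial\<close> from \<open>HOL-Library.Poly_Mapping\<close> is the lexicographic order with
  \<open>x\<^sub>1 > \<dots> > x\<^sub>n\<close>; see \<open>less_monomial_iff_lex\<close> below.
\<close>

definition lex_extension ::
    "('n monomial monomial \<Rightarrow> 'n monomial monomial \<Rightarrow> bool) \<Rightarrow>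
     ('n::linorder + 'n monomial) monomial \<Rightarrow> ('n + 'n monomial) monomial \<Rightarrow> bool" where
  "lex_extension lt m m' \<longleftrightarrow>
     lt (y_part m) (y_part m') \<or> y_part m = y_part m' \<and> x_part m < x_part m'"

text \<open>
  Since reduced Groebner bases exist and are unique, \<open>\<exists>B\<close> speaks about the reduced Groebner basis.
\<close>

definition x_condition ::
    "('n::{finite,linorder}, 'k::field) mpoly set \<Rightarrow>
     ('n monomial monomial \<Rightarrow> 'n monomial monomial \<Rightarrow> bool) \<Rightarrow> bool" where
  "x_condition I lt \<longleftrightarrow>
     (\<exists>B. reduced_groebner_basis (rees_vars I) (lex_extension lt) (rees_toric_ideal I) B \<and>
          (\<forall>g\<in>B. \<forall>m\<in>Poly_Mapping.keys g. mdeg (x_part m) \<le> 1))"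


section \<open>Basic facts about these notions\<close>

lemma less_monomial_iff_lex:
  fixes a b :: "'n::linorder monomial"
  shows "a < b \<longleftrightarrow> (\<exists>i. Poly_Mapping.lookup a i < Poly_Mapping.lookup b i \<and>
           (\<forall>j<i. Poly_Mapping.lookup a j = Poly_Mapping.lookup b j))"
  by (simp add: less_poly_mapping.rep_eq less_fun_def)

lemma module_mult: "module ((*) :: 'a::comm_ring_1 \<Rightarrow> 'a \<Rightarrow> 'a)"
  by unfold_locales (auto simp: algebra_simps)

lemma ideal_gen_UNIV: "ideal_gen UNIV B = module.span (*) B"
  unfolding ideal_gen_def module.span_explicit[OF module_mult] polys_def mons_def by auto

lemma ideal_gen_minimal:
  "B \<subseteq> ideal_gen UNIV C \<Longrightarrow> ideal_gen UNIV B \<subseteq> ideal_gen UNIV C"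
  unfolding ideal_gen_UNIV
  by (rule module.span_minimal[OF module_mult]) (auto intro: module.subspace_span[OF module_mult])

lemma keys_ideal_gen_mon:
  assumes "p \<in> ideal_gen UNIV (mon ` G)" and "m \<in> Poly_Mapping.keys p"
  shows "\<exists>u\<in>G. \<exists>c. m = u + c"
proof -
  from assms(1) obtain F q where F: "finite F" "F \<subseteq> mon ` G" and p: "p = (\<Sum>b\<in>F. q b * b)"
    unfolding ideal_gen_def by blast
  from assms(2) obtain b where b: "b \<in> F" "m \<in> Poly_Mapping.keys (q b * b)"
    unfolding p using Poly_Mapping.keys_sum[of "\<lambda>b. q b * b" F] by blast
  from b(1) F(2) obtain u where u: "u \<in> G" "b = mon u" by blast
  from b(2) keys_mult[of "q b" b] obtain c d
    where "m = c + d" "d \<in> Poly_Mapping.keys b" by blast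
  then have "m = u + c"
    using u(2) by (auto simp: add.commute split: if_splits)
  then show ?thesis using u(1) by blast
qed

lemma mon_in_ideal_gen:
  assumes "u \<in> G"
  shows "mon (u + c) \<in> ideal_gen UNIV (mon ` G)"
proof -
  have "mon u \<in> ideal_gen UNIV (mon ` G)"
    unfolding ideal_gen_UNIV using assms by (auto intro: module.span_base[OF module_mult])
  then have "mon c * mon u \<in> ideal_gen UNIV (mon ` G)"
    unfolding ideal_gen_UNIV by (rule module.span_scale[OF module_mult])
  then show ?thesis by (simp add: mult_single add.commute)
qed

lemma mon_in_ideal_gen_iff:
  "(mon m :: ('v, 'k::comm_ring_1) mpoly) \<in> ideal_gen UNIV (mon ` G) \<longleftrightarrow>
   (\<exists>u\<in>G. \<exists>c. m = u + c)"
  using keys_ideal_gen_mon[of "mon m :: ('v, 'k) mpoly" G m] mon_in_ideal_gen[of _ G]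
  by auto

lemma mdeg_eq_sum:
  assumes "finite V" and "Poly_Mapping.keys m \<subseteq> V"
  shows "mdeg m = (\<Sum>v\<in>V. Poly_Mapping.lookup m v)"
  unfolding mdeg_def using assms by (intro sum.mono_neutral_left) (auto simp: in_keys_iff)

lemma mdeg_add: "mdeg (a + b) = mdeg a + mdeg b"
proof -
  let ?V = "Poly_Mapping.keys a \<union> Poly_Mapping.keys b"
  have "mdeg (a + b) = (\<Sum>v\<in>?V. Poly_Mapping.lookup (a + b) v)"
    by (rule mdeg_eq_sum) (auto simp: keys_add)
  moreover have "mdeg a = (\<Sum>v\<in>?V. Poly_Mapping.lookup a v)"
    by (rule mdeg_eq_sum) auto
  moreover have "mdeg b = (\<Sum>v\<in>?V. Poly_Mapping.lookup b v)"
    by (rule mdeg_eq_sum) auto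
  ultimately show ?thesis by (simp add: lookup_add sum.distrib)
qed

lemma mdeg_eq_0_iff: "mdeg m = 0 \<longleftrightarrow> m = 0"
  unfolding mdeg_def by (auto simp: in_keys_iff intro: poly_mapping_eqI)

lemma ex_minimal_monomial:
  assumes "(mon u :: ('v, 'k::comm_ring_1) mpoly) \<in> I"
  shows "\<exists>v c. u = v + c \<and> (mon v :: ('v, 'k) mpoly) \<in> I \<and>
           (\<forall>w d. v = w + d \<and> (mon w :: ('v, 'k) mpoly) \<in> I \<longrightarrow> w = v)"
  using assms
proof (induction "mdeg u" arbitrary: u rule: less_induct)
  case less
  show ?case
  proof (cases "\<forall>w d. u = w + d \<and> (mon w :: ('v, 'k) mpoly) \<in> I \<longrightarrow> w = u")
    case True
    with less.prems show ?thesis by (metis add.right_neutral)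
  next
    case False
    then obtain w d where w: "u = w + d" "(mon w :: ('v, 'k) mpoly) \<in> I" "w \<noteq> u" by blast
    then have "d \<noteq> 0" by auto
    then have "mdeg w < mdeg u" using mdeg_eq_0_iff[of d] by (simp add: w(1) mdeg_add)
    from less.hyps[OF this w(2)] show ?thesis using w(1) by (metis add.assoc)
  qed
qed

lemma minimal_monomial_generators_iff:
  fixes I :: "('v, 'k::comm_ring_1) mpoly set"
  assumes "monomial_ideal I"
  shows "minimal_monomial_generators I G \<longleftrightarrow>
    G = {u. mon u \<in> I \<and> (\<forall>v c. u = v + c \<and> mon v \<in> I \<longrightarrow> v = u)}"
proof -
  define M where "M = {u. (mon u :: ('v, 'k) mpoly) \<in> I \<and>
    (\<forall>v c. u = v + c \<and> (mon v :: ('v, 'k) mpoly) \<in> I \<longrightarrow> v = u)}"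
  from assms obtain G0 where G0: "I = ideal_gen UNIV (mon ` G0)"
    unfolding monomial_ideal_def by blast
  have in_I: "(mon u :: ('v, 'k) mpoly) \<in> I"
    if "u \<in> H" "ideal_gen UNIV (mon ` H) = I" for u H
    using mon_in_ideal_gen[OF that(1), of 0] that(2) by auto
  have least: "M \<subseteq> H" if H: "ideal_gen UNIV (mon ` H) = I" for H
  proof
    fix u assume u: "u \<in> M"
    then have "(mon u :: ('v, 'k) mpoly) \<in> ideal_gen UNIV (mon ` H)"
      unfolding H M_def by blast
    then obtain v c where v: "v \<in> H" "u = v + c" unfolding mon_in_ideal_gen_iff by blast
    have "v = u" using u in_I[OF v(1) H] v(2) unfolding M_def by blast
    with v(1) show "u \<in> H" by simp
  qed
  have gen: "ideal_gen UNIV (mon ` M) = I"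
  proof
    have "mon ` M \<subseteq> I" unfolding M_def by auto
    then show "ideal_gen UNIV (mon ` M) \<subseteq> I"
      unfolding G0 by (rule ideal_gen_minimal)
    have "mon u \<in> ideal_gen UNIV (mon ` M)" if "u \<in> G0" for u
    proof -
      have "(mon u :: ('v, 'k) mpoly) \<in> I" using that G0 in_I by blast
      from ex_minimal_monomial[OF this] obtain v c where "u = v + c" "v \<in> M"
        unfolding M_def by blast
      then show ?thesis by (auto intro: mon_in_ideal_gen)
    qed
    then show "I \<subseteq> ideal_gen UNIV (mon ` M)"
      by (subst G0, intro ideal_gen_minimal) auto
  qed
  have "minimal_monomial_generators I G \<longleftrightarrow> G = M"
    unfolding minimal_monomial_generators_def using least gen by blast
  then show ?thesis unfolding M_def .
qed

lemma ex1_minimal_monomial_generators: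
  "monomial_ideal I \<Longrightarrow> \<exists>!G. minimal_monomial_generators I G"
  by (simp add: minimal_monomial_generators_iff)

lemma min_gens_eq:
  assumes "monomial_ideal I"
  shows "min_gens I = {u. mon u \<in> I \<and> (\<forall>v c. u = v + c \<and> mon v \<in> I \<longrightarrow> v = u)}"
  unfolding min_gens_def minimal_monomial_generators_iff[OF assms] by (rule the_eq_trivial)

lemma x_part_add: "x_part (a + b) = x_part a + x_part b"
  unfolding x_part_def by (simp add: map_key_plus)

lemma y_part_add: "y_part (a + b) = y_part a + y_part b"
  unfolding y_part_def by (simp add: map_key_plus)

lemma x_part_y_part_eqI:
  assumes "x_part a = x_part b" and "y_part a = y_part b"
  shows "a = b"
proof (rule poly_mapping_eqI)
  fix v
  show "Poly_Mapping.lookup a v = Poly_Mapping.lookup b v"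
  proof (cases v)
    case (Inl i)
    then show ?thesis
      using arg_cong[OF assms(1), of "\<lambda>m. Poly_Mapping.lookup m i"]
      by (simp add: x_part_def map_key.rep_eq)
  next
    case (Inr u)
    then show ?thesis
      using arg_cong[OF assms(2), of "\<lambda>m. Poly_Mapping.lookup m u"]
      by (simp add: y_part_def map_key.rep_eq)
  qed
qed

lemma y_part_in_mons: "m \<in> mons (X <+> Y) \<Longrightarrow> y_part m \<in> mons Y"
  unfolding mons_def y_part_def by (auto simp: in_keys_iff map_key.rep_eq subset_iff)

lemma monomial_order_lex_extension:
  fixes lt :: "'n::linorder monomial monomial \<Rightarrow> 'n monomial monomial \<Rightarrow> bool"
  assumes "monomial_order Y lt"
  shows "monomial_order (X <+> Y) (lex_extension lt)"
proof -
  note Y = y_part_in_mons[of _ X Y]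
  have irrefl: "irreflp_on (mons Y) lt" and trans: "transp_on (mons Y) lt"
    and total: "totalp_on (mons Y) lt"
    and pos: "\<And>a. a \<in> mons Y \<Longrightarrow> a \<noteq> 0 \<Longrightarrow> lt 0 a"
    and add: "\<And>a b c. a \<in> mons Y \<Longrightarrow> b \<in> mons Y \<Longrightarrow> c \<in> mons Y \<Longrightarrow> lt a b \<Longrightarrow>
                lt (a + c) (b + c)"
    using assms unfolding monomial_order_def by auto
  have zero: "x_part 0 = 0" "y_part 0 = (0 :: 'n monomial monomial)"
    by (auto simp: x_part_def y_part_def)
  have x_pos: "0 < x" if "x \<noteq> 0" for x :: "'n monomial"
  proof (rule ccontr)
    assume "\<not> 0 < x"
    with that have "x < 0" by auto
    then show False by (auto simp: less_monomial_iff_lex)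
  qed
  have "irreflp_on (mons (X <+> Y)) (lex_extension lt)"
    using irrefl Y by (auto simp: irreflp_on_def lex_extension_def)
  moreover have "transp_on (mons (X <+> Y)) (lex_extension lt)"
  proof (rule transp_onI)
    fix a b c :: "('n + 'n monomial) monomial"
    assume abc: "a \<in> mons (X <+> Y)" "b \<in> mons (X <+> Y)" "c \<in> mons (X <+> Y)"
      and "lex_extension lt a b" "lex_extension lt b c"
    then show "lex_extension lt a c"
      using transp_onD[OF trans Y[OF abc(1)] Y[OF abc(2)] Y[OF abc(3)]]
      by (auto simp: lex_extension_def)
  qed
  moreover have "totalp_on (mons (X <+> Y)) (lex_extension lt)"
  proof (rule totalp_onI)
    fix a b :: "('n + 'n monomial) monomial"
    assume ab: "a \<in> mons (X <+> Y)" "b \<in> mons (X <+> Y)" "a \<noteq> b"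
    show "lex_extension lt a b \<or> lex_extension lt b a"
    proof (cases "y_part a = y_part b")
      case True
      with ab(3) have "x_part a \<noteq> x_part b" using x_part_y_part_eqI by blast
      with True show ?thesis by (auto simp: lex_extension_def)
    next
      case False
      with totalp_onD[OF total Y[OF ab(1)] Y[OF ab(2)]] show ?thesis
        by (auto simp: lex_extension_def)
    qed
  qed
  moreover have "lex_extension lt 0 a" if "a \<in> mons (X <+> Y)" "a \<noteq> 0" for a
    using that x_part_y_part_eqI[of a 0] x_pos[of "x_part a"] pos[OF Y[OF that(1)]]
    by (auto simp: lex_extension_def zero)
  moreover have "lex_extension lt (a + c) (b + c)"
    if "a \<in> mons (X <+> Y)" "b \<in> mons (X <+> Y)" "c \<in> mons (X <+> Y)" "lex_extension lt a b"
    for a b c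
    using that(4) add[OF Y[OF that(1)] Y[OF that(2)] Y[OF that(3)]]
    by (auto simp: lex_extension_def x_part_add y_part_add)
  ultimately show ?thesis unfolding monomial_order_def by blast
qed

end

theory Submission
  imports Defs
begin

text \<open>
  Among the monomials in the \<open>y\<^sub>u\<close> that present a given generator \<open>w\<close> of \<open>I\<^sup>k\<close>, let \<open>w\<^sup>*\<close> be the
  least one, and order the generators by \<open>w\<^sup>*\<close>. If \<open>v\<close> precedes \<open>w\<close> and \<open>x\<^sup>a w = x\<^sup>c v\<close>, then
  \<open>x\<^sup>a w\<^sup>* - x\<^sup>c v\<^sup>*\<close> lies in the toric ideal, so its initial monomial \<open>x\<^sup>a w\<^sup>*\<close> is divisible by
  that of some Groebner basis element \<open>g\<close>. As the toric ideal is multigraded, \<open>g\<close> contains a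
  second monomial with the same image. Minimality of \<open>w\<^sup>*\<close> excludes that the initial monomial
  of \<open>g\<close> involves only the \<open>y\<^sub>u\<close>; so it is \<open>x\<^sub>l y\<^sup>b\<close>, and exchanging it for the second monomial
  turns \<open>x\<^sub>l w\<close> into a multiple of an earlier generator. Thus each colon ideal is
  generated by variables.
\<close>

section \<open>Monomials\<close>

lemma mons_add_iff: "a + b \<in> mons V \<longleftrightarrow> a \<in> mons V \<and> b \<in> mons V"
  by (auto simp: mons_def subset_iff in_keys_iff lookup_add)

lemma mons_single_iff: "Poly_Mapping.single v (Suc 0) \<in> mons V \<longleftrightarrow> v \<in> V"
  by (simp add: mons_def)

lemma mons_Plus_iff: "m \<in> mons (UNIV <+> Y) \<longleftrightarrow> y_part m \<in> mons Y"
proof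
  assume "y_part m \<in> mons Y"
  then show "m \<in> mons (UNIV <+> Y)"
    unfolding mons_def y_part_def
    by (auto simp: subset_iff in_keys_iff map_key.rep_eq Plus_def image_iff)
      (metis old.sum.exhaust)
qed (rule y_part_in_mons)

lemma mdeg_zero [simp]: "mdeg 0 = 0"
  by (simp add: mdeg_def)

lemma mdeg_single [simp]: "mdeg (Poly_Mapping.single v n) = n"
  by (simp add: mdeg_def)

lemma monomial_remove_variable:
  fixes m :: "'v monomial"
  assumes "v \<in> Poly_Mapping.keys m"
  shows "\<exists>m'. m = m' + Poly_Mapping.single v 1"
proof
  show "m = (m - Poly_Mapping.single v 1) + Poly_Mapping.single v 1"
    using assms
    by (intro poly_mapping_eqI) (auto simp: lookup_add lookup_minus lookup_single when_def in_keys_iff)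
qed

lemma mdeg_Suc_decompose:
  assumes "mdeg m = Suc n"
  shows "\<exists>m' v. m = m' + Poly_Mapping.single v 1 \<and> mdeg m' = n"
proof -
  from assms have "m \<noteq> 0" by auto
  then obtain v where "v \<in> Poly_Mapping.keys m" by fastforce
  from monomial_remove_variable[OF this] assms show ?thesis by (auto simp: mdeg_add)
qed

text \<open>Peeling off one variable at a time, by induction on the degree, suits additive
  quantities such as degrees and images under the Rees map.\<close>

lemma monomial_induct [case_names zero add]:
  fixes m :: "'v monomial"
  assumes "P 0" and "\<And>m v. P m \<Longrightarrow> P (m + Poly_Mapping.single v 1)"
  shows "P m"
proof (induction "mdeg m" arbitrary: m)
  case 0
  then show ?case using assms(1) mdeg_eq_0_iff by metis
next
  case (Suc n)
  then show ?case using mdeg_Suc_decompose[of m n] assms(2) by metis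
qed

lemma finite_monomials_of_degree:
  assumes "finite V"
  shows "finite {m \<in> mons V. mdeg m = k}"
proof (induction k)
  case 0
  have "{m \<in> mons V. mdeg m = 0} \<subseteq> {0}" by (auto simp: mdeg_eq_0_iff)
  then show ?case using finite_subset by blast
next
  case (Suc k)
  have "{m \<in> mons V. mdeg m = Suc k} \<subseteq>
      (\<lambda>(m, v). m + Poly_Mapping.single v 1) ` ({m \<in> mons V. mdeg m = k} \<times> V)"
  proof
    fix m assume m: "m \<in> {m \<in> mons V. mdeg m = Suc k}"
    then obtain m' v where "m = m' + Poly_Mapping.single v 1" "mdeg m' = k"
      using mdeg_Suc_decompose by blast
    with m show "m \<in> (\<lambda>(m, v). m + Poly_Mapping.single v 1) ` ({m \<in> mons V. mdeg m = k} \<times> V)"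
      by (auto simp: mons_add_iff mons_single_iff intro!: image_eqI[of _ _ "(m', v)"])
  qed
  then show ?case using Suc assms finite_subset by blast
qed

text \<open>The inner sum is a natural multiple of \<open>f v\<close>, written so that it makes
  sense in every commutative monoid. Exponents of products of generators and y-degrees are then
  instances of one additive function.\<close>

definition exp_sum :: "('v \<Rightarrow> 'a::comm_monoid_add) \<Rightarrow> 'v monomial \<Rightarrow> 'a" where
  "exp_sum f m = (\<Sum>v\<in>Poly_Mapping.keys m. \<Sum>i<Poly_Mapping.lookup m v. f v)"

lemma exp_sum_zero [simp]: "exp_sum f 0 = 0"
  by (simp add: exp_sum_def)

lemma exp_sum_single [simp]: "exp_sum f (Poly_Mapping.single v (Suc 0)) = f v"
  by (simp add: exp_sum_def)

lemma sum_const_lessThan_add: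
  fixes c :: "'a::comm_monoid_add" and m n :: nat
  shows "(\<Sum>i<m + n. c) = (\<Sum>i<m. c) + (\<Sum>i<n. c)"
  by (induction m) (simp_all add: add_ac)

lemma exp_sum_superset:
  assumes "finite V" and "Poly_Mapping.keys m \<subseteq> V"
  shows "exp_sum f m = (\<Sum>v\<in>V. \<Sum>i<Poly_Mapping.lookup m v. f v)"
  unfolding exp_sum_def using assms by (intro sum.mono_neutral_left) (auto simp: in_keys_iff)

lemma exp_sum_add: "exp_sum f (a + b) = exp_sum f a + exp_sum f b"
proof -
  let ?V = "Poly_Mapping.keys a \<union> Poly_Mapping.keys b"
  have "exp_sum f (a + b) = (\<Sum>v\<in>?V. \<Sum>i<Poly_Mapping.lookup (a + b) v. f v)"
    by (rule exp_sum_superset) (auto simp: keys_add)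
  moreover have "exp_sum f a = (\<Sum>v\<in>?V. \<Sum>i<Poly_Mapping.lookup a v. f v)"
    by (rule exp_sum_superset) auto
  moreover have "exp_sum f b = (\<Sum>v\<in>?V. \<Sum>i<Poly_Mapping.lookup b v. f v)"
    by (rule exp_sum_superset) auto
  ultimately show ?thesis by (simp add: lookup_add sum_const_lessThan_add sum.distrib)
qed

text \<open>Written additively, this is the product of the generators selected by a monomial in the
  \<open>y_u\<close>: the image of that monomial in \<open>S[t]\<close> with \<open>t\<close> set to
  1.\<close>

abbreviation yprod :: "'n monomial monomial \<Rightarrow> 'n monomial" where
  "yprod \<equiv> exp_sum (\<lambda>u. u)"

text \<open>Equigeneration makes the degree of a product of generators a function of the number of
  factors. The exchange argument uses this to compare x-degrees.\<close>

lemma mdeg_yprod: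
  assumes "\<And>u. u \<in> G \<Longrightarrow> mdeg u = d" and "b \<in> mons G"
  shows "mdeg (yprod b) = d * mdeg b"
  using assms(2)
  by (induction b rule: monomial_induct)
    (auto simp: exp_sum_add mdeg_add mons_add_iff mons_single_iff assms(1))

section \<open>Splitting monomials of \<open>A\<close> into x-part and y-part\<close>

lemma x_part_zero [simp]: "x_part 0 = 0" and y_part_zero [simp]: "y_part 0 = 0"
  by (simp_all add: x_part_def y_part_def)

lemma x_part_single_Inl [simp]: "x_part (Poly_Mapping.single (Inl i) n) = Poly_Mapping.single i n"
  by (simp add: x_part_def)

lemma y_part_single_Inr [simp]: "y_part (Poly_Mapping.single (Inr u) n) = Poly_Mapping.single u n"
  by (simp add: y_part_def)

lemma x_part_single_Inr [simp]: "x_part (Poly_Mapping.single (Inr u) n) = 0"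
  by (rule poly_mapping_eqI) (simp add: x_part_def map_key.rep_eq lookup_single)

lemma y_part_single_Inl [simp]: "y_part (Poly_Mapping.single (Inl i) n) = 0"
  by (rule poly_mapping_eqI) (simp add: y_part_def map_key.rep_eq lookup_single)

lemma ex_monomial_with_parts:
  fixes x :: "'n monomial" and y :: "'n monomial monomial"
  shows "\<exists>m. x_part m = x \<and> y_part m = y"
proof -
  obtain a :: "('n + 'n monomial) monomial" where a: "x_part a = x" "y_part a = 0"
  proof (induction x arbitrary: thesis rule: monomial_induct)
    case zero
    show ?case by (rule zero[of 0]) auto
  next
    case (add m v)
    from add.IH obtain a :: "('n + 'n monomial) monomial" where "x_part a = m" "y_part a = 0" .
    then show ?case
      by (intro add.prems[of "a + Poly_Mapping.single (Inl v) 1"]) (auto simp: x_part_add y_part_add)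
  qed
  obtain b :: "('n + 'n monomial) monomial" where b: "x_part b = 0" "y_part b = y"
  proof (induction y arbitrary: thesis rule: monomial_induct)
    case zero
    show ?case by (rule zero[of 0]) auto
  next
    case (add m v)
    from add.IH obtain b :: "('n + 'n monomial) monomial" where "x_part b = 0" "y_part b = m" .
    then show ?case
      by (intro add.prems[of "b + Poly_Mapping.single (Inr v) 1"]) (auto simp: x_part_add y_part_add)
  qed
  show ?thesis
    using a b by (intro exI[of _ "a + b"]) (auto simp: x_part_add y_part_add)
qed


section \<open>Monomial ideals\<close>

lemma poly_mapping_sum_singles:
  fixes p :: "'a \<Rightarrow>\<^sub>0 'b::comm_monoid_add"
  shows "p = (\<Sum>m\<in>Poly_Mapping.keys p. Poly_Mapping.single m (Poly_Mapping.lookup p m))"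
  by (rule poly_mapping_eqI)
    (simp add: lookup_sum lookup_single when_def sum.delta' in_keys_iff)

lemma lookup_times_mon:
  fixes h :: "('v, 'k::comm_ring_1) mpoly"
  shows "Poly_Mapping.lookup (h * mon w) (m + w) = Poly_Mapping.lookup h m"
proof -
  have "h * mon w = (\<Sum>m\<in>Poly_Mapping.keys h. Poly_Mapping.single (m + w) (Poly_Mapping.lookup h m))"
    by (subst poly_mapping_sum_singles[of h]) (simp add: sum_distrib_right mult_single)
  then show ?thesis
    by (simp add: lookup_sum lookup_single when_def sum.delta' in_keys_iff)
qed

text \<open>An ideal generated by monomials contains each term of its elements, and is closed under
  adding scalar multiples of its monomials. Membership thus reduces to divisibility of the
  supporting monomials.\<close>

lemma in_ideal_gen_mon_iff:
  "p \<in> ideal_gen UNIV (mon ` A) \<longleftrightarrow> (\<forall>m\<in>Poly_Mapping.keys p. \<exists>u\<in>A. \<exists>c. m = u + c)"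
proof
  assume keys: "\<forall>m\<in>Poly_Mapping.keys p. \<exists>u\<in>A. \<exists>c. m = u + c"
  have "Poly_Mapping.single m a \<in> ideal_gen UNIV (mon ` A)" if "m \<in> Poly_Mapping.keys p" for m a
  proof -
    from keys that have "mon m \<in> ideal_gen UNIV (mon ` A)" by (metis mon_in_ideal_gen)
    then have "Poly_Mapping.single 0 a * mon m \<in> ideal_gen UNIV (mon ` A)"
      unfolding ideal_gen_UNIV by (rule module.span_scale[OF module_mult])
    then show ?thesis by (simp add: mult_single)
  qed
  then have "(\<Sum>m\<in>Poly_Mapping.keys p. Poly_Mapping.single m (Poly_Mapping.lookup p m))
      \<in> ideal_gen UNIV (mon ` A)"
    unfolding ideal_gen_UNIV by (intro module.span_sum[OF module_mult])
  then show "p \<in> ideal_gen UNIV (mon ` A)" using poly_mapping_sum_singles[of p] by simp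
qed (use keys_ideal_gen_mon in blast)

text \<open>Multiplication by a monomial shifts exponents injectively, so no terms cancel.\<close>

lemma keys_times_mon_iff:
  "(\<forall>m\<in>Poly_Mapping.keys (h * mon w). P m) \<longleftrightarrow> (\<forall>m\<in>Poly_Mapping.keys h. P (m + w))"
proof
  assume "\<forall>m\<in>Poly_Mapping.keys (h * mon w). P m"
  then show "\<forall>m\<in>Poly_Mapping.keys h. P (m + w)"
    using lookup_times_mon[of h w] by (auto simp: in_keys_iff)
next
  assume "\<forall>m\<in>Poly_Mapping.keys h. P (m + w)"
  then show "\<forall>m\<in>Poly_Mapping.keys (h * mon w). P m"
    using keys_mult[of h "mon w"] by (fastforce split: if_splits)
qed

text \<open>The colon ideal is decided monomial by monomial. The assumption says that each of its
  monomials is divisible by a variable already lying in it, which is generation by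
  variables.\<close>

lemma colon_mon_eq_variables:
  assumes "\<And>m u c. u \<in> W \<Longrightarrow> m + w = u + c \<Longrightarrow>
    \<exists>l\<in>Poly_Mapping.keys m. \<exists>v\<in>W. \<exists>e. Poly_Mapping.single l 1 + w = v + e"
  shows "colon (ideal_gen UNIV (mon ` W)) (mon w) = ideal_gen UNIV
    (mon ` {Poly_Mapping.single l 1 | l. \<exists>v\<in>W. \<exists>e. Poly_Mapping.single l 1 + w = v + e})"
    (is "?C = ideal_gen UNIV (mon ` ?L)")
proof (intro set_eqI)
  fix h
  have iff: "(\<exists>u\<in>W. \<exists>c. m + w = u + c) \<longleftrightarrow> (\<exists>u\<in>?L. \<exists>c. m = u + c)" for m
  proof
    assume "\<exists>u\<in>W. \<exists>c. m + w = u + c"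
    then obtain u c where "u \<in> W" "m + w = u + c" by blast
    from assms[OF this] obtain l where l: "l \<in> Poly_Mapping.keys m"
      and L: "Poly_Mapping.single l 1 \<in> ?L" by auto
    from monomial_remove_variable[OF l] obtain m' where "m = Poly_Mapping.single l 1 + m'"
      by (metis add.commute)
    with L show "\<exists>u\<in>?L. \<exists>c. m = u + c" by blast
  next
    assume "\<exists>u\<in>?L. \<exists>c. m = u + c"
    then obtain u c where "u \<in> ?L" and m: "m = u + c" by blast
    then obtain l v e where u: "u = Poly_Mapping.single l 1"
      and "v \<in> W" and "Poly_Mapping.single l 1 + w = v + e" by blast
    then have "m + w = (v + e) + c" unfolding m u by (metis add.assoc add.commute)
    then have "m + w = v + (e + c)" by (simp only: add.assoc)
    with \<open>v \<in> W\<close> show "\<exists>u\<in>W. \<exists>c. m + w = u + c" by blast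
  qed
  have "h \<in> ?C \<longleftrightarrow> (\<forall>m\<in>Poly_Mapping.keys h. \<exists>u\<in>W. \<exists>c. m + w = u + c)"
    unfolding colon_def mem_Collect_eq in_ideal_gen_mon_iff
    by (rule keys_times_mon_iff)
  also have "\<dots> \<longleftrightarrow> h \<in> ideal_gen UNIV (mon ` ?L)"
    unfolding in_ideal_gen_mon_iff by (intro ball_cong refl iff)
  finally show "h \<in> ?C \<longleftrightarrow> h \<in> ideal_gen UNIV (mon ` ?L)" .
qed

section \<open>Generators of \<open>I\<close> and of its powers\<close>

lemma ideal_gen_min_gens:
  "monomial_ideal I \<Longrightarrow> ideal_gen UNIV (mon ` min_gens I) = I"
  using theI'[OF ex1_minimal_monomial_generators]
  unfolding min_gens_def minimal_monomial_generators_def by blast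

text \<open>A minimal generator \<open>u\<close> occurs in some \<open>q f * f\<close> with
  \<open>f\<close> homogeneous of degree \<open>d\<close>, so it is a multiple of a monomial
  \<open>m\<close> of \<open>f\<close>. Since \<open>I\<close> is a monomial ideal, \<open>m\<close>
  lies in it, and minimality forces \<open>m = u\<close>.\<close>

lemma min_gens_equigenerated:
  assumes "monomial_ideal I" and "generated_in_one_degree I"
  shows "\<exists>d. \<forall>u\<in>min_gens I. mdeg u = d"
proof -
  from assms(2) obtain d F where F: "\<And>f. f \<in> F \<Longrightarrow> homogeneous d f" "I = ideal_gen UNIV F"
    unfolding generated_in_one_degree_def by blast
  from assms(1) obtain A where A: "I = ideal_gen UNIV (mon ` A)"
    unfolding monomial_ideal_def by blast
  have "mdeg u = d" if u: "u \<in> min_gens I" for u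
  proof -
    from u have mon_u: "mon u \<in> I" and min: "\<And>v c. u = v + c \<Longrightarrow> mon v \<in> I \<Longrightarrow> v = u"
      unfolding min_gens_eq[OF assms(1)] by auto
    from mon_u obtain E q where E: "E \<subseteq> F" and sum: "mon u = (\<Sum>f\<in>E. q f * f)"
      unfolding F(2) ideal_gen_def by blast
    have "u \<in> Poly_Mapping.keys (\<Sum>f\<in>E. q f * f)" unfolding sum[symmetric] by simp
    then obtain f where f: "f \<in> E" "u \<in> Poly_Mapping.keys (q f * f)"
      using Poly_Mapping.keys_sum[of "\<lambda>f. q f * f" E] by blast
    then obtain c m where m: "u = c + m" "m \<in> Poly_Mapping.keys f"
      using keys_mult[of "q f" f] by blast
    have "f \<in> I" unfolding F(2) ideal_gen_UNIV using f E
      by (auto intro: module.span_base[OF module_mult])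
    then have "mon m \<in> I" using m(2) unfolding A in_ideal_gen_mon_iff by simp
    then have "m = u" using min m(1) by (metis add.commute)
    then show ?thesis using F(1) f(1) E m(2) unfolding homogeneous_def by blast
  qed
  then show ?thesis by blast
qed

text \<open>Products of arbitrary elements of \<open>I\<close> generate the power, so one inclusion
  splits each monomial of such a product into monomials of the factors. The other reads a monomial
  in the \<open>y_u\<close> as a list of generators.\<close>

lemma ideal_power_monomial:
  assumes I: "I = ideal_gen UNIV (mon ` G)"
  shows "ideal_power I k = ideal_gen UNIV (mon ` yprod ` {b \<in> mons G. mdeg b = k})"
    (is "_ = ?R k")
proof
  have "prod_list fs \<in> ?R (length fs)" if "set fs \<subseteq> I" for fs
    using that
  proof (induction fs)
    case Nil
    have "0 \<in> mons G" by (simp add: mons_def)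
    then show ?case unfolding in_ideal_gen_mon_iff by (auto intro!: bexI[of _ 0])
  next
    case (Cons f fs)
    show ?case
      unfolding in_ideal_gen_mon_iff
    proof
      fix m assume "m \<in> Poly_Mapping.keys (prod_list (f # fs))"
      then obtain a b where ab: "a \<in> Poly_Mapping.keys f" "b \<in> Poly_Mapping.keys (prod_list fs)"
        and m: "m = a + b"
        using keys_mult[of f "prod_list fs"] by auto
      from ab(1) Cons.prems obtain u c where u: "u \<in> G" "a = u + c"
        unfolding I using keys_ideal_gen_mon by fastforce
      from ab(2) Cons obtain v e where v: "v \<in> mons G" "mdeg v = length fs" "b = yprod v + e"
        unfolding in_ideal_gen_mon_iff by auto
      have "v + Poly_Mapping.single u 1 \<in> {b \<in> mons G. mdeg b = length (f # fs)}"
        using u v by (simp add: mons_add_iff mons_single_iff mdeg_add)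
      moreover have "m = yprod (v + Poly_Mapping.single u 1) + (c + e)"
        using u v m by (simp add: exp_sum_add ac_simps)
      ultimately show "\<exists>u\<in>yprod ` {b \<in> mons G. mdeg b = length (f # fs)}. \<exists>c. m = u + c"
        by blast
    qed
  qed
  then show "ideal_power I k \<subseteq> ?R k"
    unfolding ideal_power_def by (intro ideal_gen_minimal) auto
  have "\<exists>fs. mon (yprod b) = prod_list fs \<and> length fs = k \<and> set fs \<subseteq> I"
    if "b \<in> mons G" "mdeg b = k" for b k
    using that
  proof (induction b arbitrary: k rule: monomial_induct)
    case zero
    then show ?case by (auto intro: exI[of _ "[]"])
  next
    case (add b u)
    then have b: "b \<in> mons G" and u: "u \<in> G" by (auto simp: mons_add_iff mons_single_iff)
    from add.IH[OF b refl] obtain fs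
      where fs: "mon (yprod b) = prod_list fs" "length fs = mdeg b" "set fs \<subseteq> I" by blast
    have "mon u \<in> I" using mon_in_ideal_gen[OF u, of 0] unfolding I by simp
    moreover have "mon (yprod (b + Poly_Mapping.single u 1)) = prod_list (mon u # fs)"
      by (simp add: exp_sum_add mult_single add.commute flip: fs(1))
    ultimately show ?case
      using fs add.prems by (intro exI[of _ "mon u # fs"]) (auto simp: mdeg_add)
  qed
  then have "mon ` yprod ` {b \<in> mons G. mdeg b = k}
      \<subseteq> ideal_gen UNIV {prod_list fs | fs. length fs = k \<and> set fs \<subseteq> I}"
    unfolding ideal_gen_UNIV by (fastforce intro: module.span_base[OF module_mult])
  then show "?R k \<subseteq> ideal_power I k"
    unfolding ideal_power_def by (rule ideal_gen_minimal)
qed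


section \<open>The toric ideal\<close>

text \<open>The order is only controlled on \<open>mons V\<close>; there the finite nonempty support
  has a unique greatest element, which makes the definite description meaningful.\<close>

lemma init_mon_greatest:
  assumes "monomial_order V lt" and "f \<in> polys V" and "f \<noteq> 0"
  shows "init_mon lt f \<in> Poly_Mapping.keys f \<and>
    (\<forall>m\<in>Poly_Mapping.keys f. m \<noteq> init_mon lt f \<longrightarrow> lt m (init_mon lt f))"
proof -
  let ?P = "\<lambda>m. m \<in> Poly_Mapping.keys f \<and> (\<forall>m'\<in>Poly_Mapping.keys f. m' \<noteq> m \<longrightarrow> lt m' m)"
  have sub: "Poly_Mapping.keys f \<subseteq> mons V" using assms(2) by (simp add: polys_def)
  have irrefl: "irreflp_on (mons V) lt" and trans: "transp_on (mons V) lt"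
    and total: "totalp_on (mons V) lt"
    using assms(1) by (auto simp: monomial_order_def)
  have "\<exists>m. ?P m"
    using Finite_Set.bex_greatest_element[of "Poly_Mapping.keys f" lt] assms(3)
      transp_on_subset[OF trans sub] totalp_on_subset[OF total sub] by auto
  moreover have "m = m'" if "?P m" "?P m'" for m m'
    using that sub irrefl trans
    by (metis (no_types, lifting) irreflp_onD transp_onD subsetD)
  ultimately have "\<exists>!m. ?P m" by blast
  from theI'[OF this] show ?thesis unfolding init_mon_def .
qed

section \<open>The Rees map on monomials and its multigrading\<close>

definition rees_exp :: "('n + 'n monomial) monomial \<Rightarrow> 'n monomial" where
  "rees_exp m = x_part m + yprod (y_part m)"

lemma rees_exp_eq_exp_sum:
  "rees_exp m = exp_sum (case_sum (\<lambda>i. Poly_Mapping.single i (Suc 0)) (\<lambda>u. u)) m"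
proof (induction m rule: monomial_induct)
  case (add m v)
  show ?case
    using add.IH[symmetric] by (cases v) (auto simp: rees_exp_def x_part_add y_part_add exp_sum_add ac_simps)
qed (simp add: rees_exp_def)

lemma mdeg_y_part_eq_exp_sum:
  "mdeg (y_part m) = exp_sum (case_sum (\<lambda>_. 0) (\<lambda>_. Suc 0)) m"
proof (induction m rule: monomial_induct)
  case (add m v)
  then show ?case by (cases v) (auto simp: y_part_add exp_sum_add mdeg_add)
qed simp

lemma mon_power: "(mon u :: ('v, 'k::comm_ring_1) mpoly) ^ n = mon (\<Sum>i<n. u)"
  by (induction n) (simp_all add: mult_single add.commute)

lemma prod_monom_mon:
  "(\<Prod>v\<in>A. monom (mon (f v) :: ('v, 'k::comm_ring_1) mpoly) (g v)) = monom (mon (sum f A)) (sum g A)"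
  by (induction A rule: infinite_finite_induct) (simp_all add: mult_single mult_monom)

text \<open>The map sends monomials to monomials: \<open>rees_exp\<close> is the x-exponent of the
  image and the y-degree its exponent of \<open>t\<close>. This pair is the multidegree.\<close>

lemma rees_map_eq:
  fixes p :: "('n + 'n monomial, 'k::comm_ring_1) mpoly"
  shows "rees_map p = (\<Sum>m\<in>Poly_Mapping.keys p.
    monom (Poly_Mapping.single (rees_exp m) (Poly_Mapping.lookup p m)) (mdeg (y_part m)))"
proof -
  let ?\<phi> = "case_sum (\<lambda>i. [:mon (Poly_Mapping.single i 1):]) (\<lambda>u. monom (mon u) 1)
    :: 'n + 'n monomial \<Rightarrow> ('n, 'k) mpoly poly"
  have \<phi>: "?\<phi> v = monom (mon (case_sum (\<lambda>i. Poly_Mapping.single i (Suc 0)) (\<lambda>u. u) v))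
    (case_sum (\<lambda>_. 0) (\<lambda>_. Suc 0) v)" for v
    by (cases v) (auto simp: monom_0)
  have "(\<Prod>v\<in>Poly_Mapping.keys m. ?\<phi> v ^ Poly_Mapping.lookup m v)
      = monom (mon (rees_exp m)) (mdeg (y_part m))" for m
    unfolding \<phi> monom_power mon_power prod_monom_mon rees_exp_eq_exp_sum mdeg_y_part_eq_exp_sum
    by (simp add: exp_sum_def mult.commute)
  then show ?thesis
    unfolding rees_map_def eval_mpoly_def by (simp add: smult_monom mult_single)
qed

text \<open>If \<open>m0\<close> were the only monomial of \<open>p\<close> in its multidegree, its
  nonzero coefficient would survive in \<open>rees_map p\<close>.\<close>

lemma rees_toric_ideal_cancelling_monomial:
  fixes p :: "('n + 'n monomial, 'k::comm_ring_1) mpoly"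
  assumes "rees_map p = 0" and "m0 \<in> Poly_Mapping.keys p"
  shows "\<exists>m\<in>Poly_Mapping.keys p. m \<noteq> m0 \<and> rees_exp m = rees_exp m0 \<and>
    mdeg (y_part m) = mdeg (y_part m0)"
proof (rule ccontr)
  assume contra: "\<not> ?thesis"
  have "Poly_Mapping.lookup (coeff (rees_map p) (mdeg (y_part m0))) (rees_exp m0)
     = (\<Sum>m\<in>Poly_Mapping.keys p. if m = m0 then Poly_Mapping.lookup p m else 0)"
    unfolding rees_map_eq coeff_sum lookup_sum
    using contra by (intro sum.cong) (auto simp: lookup_single when_def)
  also have "\<dots> = Poly_Mapping.lookup p m0" using assms(2) by simp
  finally show False using assms by (simp add: in_keys_iff)
qed

lemma binomial_in_rees_toric_ideal:
  fixes m m' :: "('n + 'n monomial) monomial"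
  assumes "m \<in> mons (rees_vars I)" "m' \<in> mons (rees_vars I)" and "m \<noteq> m'"
    and "rees_exp m = rees_exp m'" and "mdeg (y_part m) = mdeg (y_part m')"
  shows "(mon m - mon m' :: ('n + 'n monomial, 'k::comm_ring_1) mpoly) \<in> rees_toric_ideal I"
    and "Poly_Mapping.keys (mon m - mon m' :: ('n + 'n monomial, 'k) mpoly) = {m, m'}"
proof -
  let ?f = "mon m - mon m' :: ('n + 'n monomial, 'k) mpoly"
  show keys: "Poly_Mapping.keys ?f = {m, m'}"
    using assms(3) by (auto simp: in_keys_iff lookup_minus lookup_single when_def split: if_splits)
  have "rees_map ?f = 0"
    unfolding rees_map_eq keys
    using assms(3-5) by (simp add: lookup_minus lookup_single add_monom flip: single_add)
  then show "?f \<in> rees_toric_ideal I"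
    unfolding rees_toric_ideal_def polys_def using keys assms by auto
qed

text \<open>For a monomial order these are the standard monomials of the toric ideal of
  \<open>K[ut]\<close>: the least elements of the fibres of \<open>y_u \<mapsto> ut\<close>.\<close>

definition standard :: "'n monomial set \<Rightarrow> ('n monomial monomial \<Rightarrow> 'n monomial monomial \<Rightarrow> bool) \<Rightarrow>
    'n monomial monomial \<Rightarrow> bool" where
  "standard G lt b \<longleftrightarrow>
     b \<in> mons G \<and> (\<forall>a\<in>mons G. mdeg a = mdeg b \<and> yprod a = yprod b \<longrightarrow> \<not> lt a b)"

text \<open>Fixing the degree makes each fibre finite. The final alternative ensures that passing to
  the standard representative never moves up in the order.\<close>

lemma ex_standard:
  assumes "monomial_order G lt" and "finite G" and "b \<in> mons G"
  shows "\<exists>a. standard G lt a \<and> mdeg a = mdeg b \<and> yprod a = yprod b \<and> (a = b \<or> lt a b)"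
proof -
  let ?A = "{a \<in> mons G. mdeg a = mdeg b \<and> yprod a = yprod b}"
  have irrefl: "irreflp_on (mons G) lt" and trans: "transp_on (mons G) lt"
    and total: "totalp_on (mons G) lt"
    using assms(1) by (auto simp: monomial_order_def)
  have "?A \<subseteq> {a \<in> mons G. mdeg a = mdeg b}" by auto
  then have "finite ?A" using finite_monomials_of_degree[OF assms(2)] by (rule finite_subset)
  moreover have "?A \<noteq> {}" using assms(3) by auto
  moreover have sub: "?A \<subseteq> mons G" by auto
  ultimately have "\<exists>a\<in>?A. \<forall>c\<in>?A. c \<noteq> a \<longrightarrow> lt a c"
    using transp_on_subset[OF trans sub] totalp_on_subset[OF total sub]
    by (intro Finite_Set.bex_least_element)
  then obtain a where a: "a \<in> ?A" "\<And>c. c \<in> ?A \<Longrightarrow> c \<noteq> a \<Longrightarrow> lt a c" by blast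
  have "\<not> lt c a" if c: "c \<in> ?A" for c
  proof
    assume "lt c a"
    with irrefl a(1) c have "c \<noteq> a" by (auto dest: irreflp_onD)
    with a(2)[OF c] have "lt a c" by blast
    with \<open>lt c a\<close> a(1) c trans irrefl show False
      by (metis (no_types, lifting) irreflp_onD transp_onD mem_Collect_eq)
  qed
  then show ?thesis
    using a assms(3) unfolding standard_def by (intro exI[of _ a]) auto
qed

text \<open>Only \<open>b\<close> has to be standard. The resulting \<open>a\<close> need not be; a
  standard representative of it is chosen when the lemma is applied.\<close>

lemma x_condition_exchange:
  fixes I :: "('n::{finite,linorder}, 'k::field) mpoly set"
  assumes order: "monomial_order (min_gens I) lt"
    and x_cond: "x_condition I lt"
    and deg: "\<And>u. u \<in> min_gens I \<Longrightarrow> mdeg u = d"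
    and b: "standard (min_gens I) lt b" and b': "b' \<in> mons (min_gens I)"
    and "mdeg b' = mdeg b" and less: "lt b' b" and eq: "m + yprod b = c + yprod b'"
  shows "\<exists>l\<in>Poly_Mapping.keys m. \<exists>a\<in>mons (min_gens I).
    mdeg a = mdeg b \<and> lt a b \<and> (\<exists>e. Poly_Mapping.single l 1 + yprod b = yprod a + e)"
proof -
  let ?G = "min_gens I" and ?V = "rees_vars I" and ?lt = "lex_extension lt"
  have irrefl: "\<And>a. a \<in> mons ?G \<Longrightarrow> \<not> lt a a" and
    trans: "\<And>a b c. a \<in> mons ?G \<Longrightarrow> b \<in> mons ?G \<Longrightarrow> c \<in> mons ?G \<Longrightarrow> lt a b \<Longrightarrow> lt b c \<Longrightarrow> lt a c"
    and add: "\<And>a b c. a \<in> mons ?G \<Longrightarrow> b \<in> mons ?G \<Longrightarrow> c \<in> mons ?G \<Longrightarrow> lt a b \<Longrightarrow> lt (a + c) (b + c)"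
    using order unfolding monomial_order_def by (auto dest: irreflp_onD transp_onD)
  have bG: "b \<in> mons ?G" using b by (simp add: standard_def)
  have order': "monomial_order ?V ?lt"
    unfolding rees_vars_def by (rule monomial_order_lex_extension[OF order])
  from x_cond obtain B where "reduced_groebner_basis ?V ?lt (rees_toric_ideal I) B"
    and linear: "\<forall>g\<in>B. \<forall>m\<in>Poly_Mapping.keys g. mdeg (x_part m) \<le> 1"
    unfolding x_condition_def by blast
  then have B: "groebner_basis ?V ?lt (rees_toric_ideal I) B"
    by (simp only: reduced_groebner_basis_def)
  obtain M :: "('n + 'n monomial) monomial" where M: "x_part M = m" "y_part M = b"
    using ex_monomial_with_parts[of m b] by blast
  obtain M' :: "('n + 'n monomial) monomial" where M': "x_part M' = c" "y_part M' = b'"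
    using ex_monomial_with_parts[of c b'] by blast
  have MV: "M \<in> mons ?V" "M' \<in> mons ?V"
    using M M' bG b' by (auto simp: rees_vars_def mons_Plus_iff)
  have "b \<noteq> b'" using less irrefl b' by auto
  define f where "f = (mon M - mon M' :: ('n + 'n monomial, 'k) mpoly)"
  have f: "f \<in> rees_toric_ideal I" "Poly_Mapping.keys f = {M, M'}"
    unfolding f_def using MV M M' \<open>b \<noteq> b'\<close> eq \<open>mdeg b' = mdeg b\<close>
    by (intro binomial_in_rees_toric_ideal; auto simp: rees_exp_def)+
  \<comment> \<open>The extended order compares y-parts first, so \<open>lt b' b\<close> settles the
    comparison whatever \<open>m\<close> and \<open>c\<close> are.\<close>
  have init_f: "init_mon ?lt f = M"
  proof (rule ccontr)
    assume "init_mon ?lt f \<noteq> M"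
    moreover have "f \<in> polys ?V" "f \<noteq> 0"
      using f by (auto simp: rees_toric_ideal_def)
    ultimately have "?lt M M'"
      using init_mon_greatest[OF order', of f] f(2) by auto
    then have "lt b b'" using M M' \<open>b \<noteq> b'\<close> by (simp add: lex_extension_def)
    then show False using trans[OF bG b' bG] less irrefl[OF bG] by blast
  qed
  have "mon (init_mon ?lt f) \<in> init_ideal ?V ?lt (rees_toric_ideal I)"
    unfolding init_ideal_def ideal_gen_def using f
    by (intro CollectI exI[of _ "{mon (init_mon ?lt f)}"] exI[of _ "\<lambda>_. 1"])
      (auto simp: polys_def mons_def)
  then have "mon M \<in> ideal_gen ?V (mon ` init_mon ?lt ` B :: ('n + 'n monomial, 'k) mpoly set)"
    using B unfolding init_f groebner_basis_def by (simp add: image_image)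
  \<comment> \<open>Allowing coefficients outside \<open>polys ?V\<close> can only enlarge the
    ideal, and makes the divisibility criterion for \<open>UNIV\<close> applicable.\<close>
  then have "mon M \<in> ideal_gen UNIV (mon ` init_mon ?lt ` B :: ('n + 'n monomial, 'k) mpoly set)"
    unfolding ideal_gen_def polys_def mons_def by blast
  then obtain g r where g: "g \<in> B" and M_eq: "M = init_mon ?lt g + r"
    unfolding mon_in_ideal_gen_iff by blast
  have gJ: "g \<in> rees_toric_ideal I" "g \<noteq> 0" using g B by (auto simp: groebner_basis_def)
  then have g_polys: "g \<in> polys ?V" and g_map: "rees_map g = 0"
    by (auto simp: rees_toric_ideal_def)
  define m0 where "m0 = init_mon ?lt g"
  have m0: "m0 \<in> Poly_Mapping.keys g"
    and less_m0: "\<And>m. m \<in> Poly_Mapping.keys g \<Longrightarrow> m \<noteq> m0 \<Longrightarrow> ?lt m m0"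
    using init_mon_greatest[OF order' g_polys gJ(2)] unfolding m0_def by auto
  from rees_toric_ideal_cancelling_monomial[OF g_map m0] obtain m1
    where m1: "m1 \<in> Poly_Mapping.keys g" "m1 \<noteq> m0" "rees_exp m1 = rees_exp m0"
      "mdeg (y_part m1) = mdeg (y_part m0)" by blast
  have lt10: "?lt m1 m0" using less_m0 m1 by blast
  define x0 y0 x1 y1 xr yr where defs: "x0 = x_part m0" "y0 = y_part m0" "x1 = x_part m1"
    "y1 = y_part m1" "xr = x_part r" "yr = y_part r"
  have m_eq: "m = x0 + xr" and b_eq: "b = y0 + yr"
    using M M_eq unfolding defs m0_def by (auto simp: x_part_add y_part_add)
  have yG: "y0 \<in> mons ?G" "y1 \<in> mons ?G" "yr \<in> mons ?G"
    using bG m1(1) g_polys unfolding b_eq mons_add_iff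
    by (auto simp: defs polys_def rees_vars_def mons_Plus_iff subset_iff)
  have image_eq: "x1 + yprod y1 = x0 + yprod y0" and ydeg: "mdeg y1 = mdeg y0"
    using m1 unfolding rees_exp_def defs by auto
  \<comment> \<open>Images and y-degrees agree, and every generator has degree \<open>d\<close>, so
    the x-degrees agree as well.\<close>
  have xdeg: "mdeg x1 = mdeg x0"
    using arg_cong[OF image_eq, of mdeg] mdeg_yprod[OF deg yG(1)] mdeg_yprod[OF deg yG(2)] ydeg
    by (simp add: mdeg_add)
  \<comment> \<open>Equal y-parts would cancel in \<open>image_eq\<close> and force
    \<open>m1 = m0\<close>. Hence the y-parts decide that \<open>m1\<close> is smaller.\<close>
  have "y1 \<noteq> y0"
    using image_eq m1(2) x_part_y_part_eqI[of m1 m0] unfolding defs by auto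
  then have "lt y1 y0" using lt10 unfolding lex_extension_def defs by auto
  \<comment> \<open>The factor \<open>y0\<close> of \<open>b\<close> is replaced by
    \<open>y1\<close>, which lowers the monomial and keeps its degree.\<close>
  define a where "a = y1 + yr"
  have aG: "a \<in> mons ?G" and a_deg: "mdeg a = mdeg b" and a_less: "lt a b"
    using yG ydeg add[OF yG(2,1,3) \<open>lt y1 y0\<close>] unfolding a_def b_eq
    by (auto simp: mons_add_iff mdeg_add)
  have a_eq: "x0 + yprod b = x1 + yprod a"
    unfolding a_def b_eq exp_sum_add using image_eq by (metis add.assoc)
  \<comment> \<open>Without x-variables the exchange would give a smaller monomial in the fibre of
    \<open>b\<close>, against standardness.\<close>
  have "x0 \<noteq> 0"
  proof
    assume "x0 = 0"
    with xdeg have "x1 = 0" by (metis mdeg_eq_0_iff)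
    with a_eq \<open>x0 = 0\<close> have "yprod a = yprod b" by simp
    with b aG a_deg a_less show False unfolding standard_def by blast
  qed
  \<comment> \<open>The x-condition bounds the x-degree of the initial monomial; with
    \<open>x0 \<noteq> 0\<close> exactly one variable remains.\<close>
  moreover have "mdeg x0 \<le> 1" using linear g m0 by (simp add: defs)
  ultimately have "mdeg x0 = Suc 0" by (metis One_nat_def le_SucE le_zero_eq mdeg_eq_0_iff)
  then obtain l where l: "x0 = Poly_Mapping.single l 1"
    using mdeg_Suc_decompose[of x0 0] by (auto simp: mdeg_eq_0_iff)
  have "l \<in> Poly_Mapping.keys m" unfolding m_eq l by (simp add: in_keys_iff lookup_add)
  moreover have "Poly_Mapping.single l 1 + yprod b = yprod a + x1"
    using a_eq unfolding l by (simp add: add.commute)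
  ultimately show ?thesis using aG a_deg a_less by blast
qed


section \<open>Linear quotients\<close>

text \<open>The order is a predicate that is controlled only on a set, so the list is built by
  repeatedly extracting a least element.\<close>

lemma ex_sorted_wrt_list:
  assumes "finite A" and "transp_on A R" and "totalp_on A R"
  shows "\<exists>xs. set xs = A \<and> sorted_wrt R xs"
  using assms
proof (induction A rule: finite_psubset_induct)
  case (psubset A)
  show ?case
  proof (cases "A = {}")
    case True
    then show ?thesis by (auto intro: exI[of _ "[]"])
  next
    case False
    with psubset obtain l where l: "l \<in> A" "\<And>x. x \<in> A \<Longrightarrow> x \<noteq> l \<Longrightarrow> R l x"
      using Finite_Set.bex_least_element[of A R] by blast
    have "A - {l} \<subset> A" using l(1) by blast
    from psubset.IH[OF this] psubset.prems obtain xs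
      where "set xs = A - {l}" "sorted_wrt R xs"
      by (meson Diff_subset transp_on_subset totalp_on_subset)
    with l show ?thesis by (intro exI[of _ "l # xs"]) auto
  qed
qed

theorem theorem2p5:
  fixes I :: "(('n::{finite,linorder} \<Rightarrow>\<^sub>0 nat) \<Rightarrow>\<^sub>0 'k::field) set"
    and lt :: "(('n \<Rightarrow>\<^sub>0 nat) \<Rightarrow>\<^sub>0 nat) \<Rightarrow> (('n \<Rightarrow>\<^sub>0 nat) \<Rightarrow>\<^sub>0 nat) \<Rightarrow> bool"
    and k :: nat
  assumes "monomial_ideal I"
    and "I \<noteq> {0}"
    and "I \<noteq> UNIV"
    and "generated_in_one_degree I"
    and "monomial_order (min_gens I) lt"
    and "x_condition I lt"
    and "k \<ge> 1"
  shows "has_linear_quotients (ideal_power I k)"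
proof -
  define G where "G = min_gens I"
  have I: "I = ideal_gen UNIV (mon ` G)"
    unfolding G_def using ideal_gen_min_gens[OF assms(1)] by simp
  obtain d where d: "\<And>u. u \<in> G \<Longrightarrow> mdeg u = d"
    using min_gens_equigenerated[OF assms(1,4)] unfolding G_def by blast
  \<comment> \<open>Since \<open>I\<close> is nonzero, \<open>G\<close> is nonempty; a generator of
    degree 0 would be the unit monomial, making \<open>I\<close> the whole ring.\<close>
  have "d \<noteq> 0"
  proof
    assume "d = 0"
    have "G \<noteq> {}" using assms(2) unfolding I by (auto simp: ideal_gen_def)
    with d \<open>d = 0\<close> have "0 \<in> G" by (metis all_not_in_conv mdeg_eq_0_iff)
    then have "I = UNIV" unfolding I by (auto simp: in_ideal_gen_mon_iff intro!: bexI[of _ 0])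
    with assms(3) show False by blast
  qed
  have "finite G"
    using finite_subset[OF _ finite_monomials_of_degree[of "UNIV :: 'n set" d], of G] d
    by (auto simp: mons_def)
  have order: "monomial_order G lt" using assms(5) by (simp add: G_def)
  have irrefl: "irreflp_on (mons G) lt" and trans: "transp_on (mons G) lt"
    and total: "totalp_on (mons G) lt"
    using order by (auto simp: monomial_order_def)
  \<comment> \<open>By totality each fibre contains exactly one standard monomial, so sorting
    \<open>S\<close> lists each product of \<open>k\<close> generators once.\<close>
  define S where "S = {b. standard G lt b \<and> mdeg b = k}"
  have SG: "S \<subseteq> mons G" by (auto simp: S_def standard_def)
  have "S \<subseteq> {b \<in> mons G. mdeg b = k}" using SG by (auto simp: S_def)
  then have "finite S" using finite_monomials_of_degree[OF \<open>finite G\<close>] by (rule finite_subset)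
  then obtain bs where bs: "set bs = S" "sorted_wrt lt bs"
    using ex_sorted_wrt_list transp_on_subset[OF trans SG] totalp_on_subset[OF total SG] by blast
  define fs :: "('n, 'k) mpoly list" where "fs = map (\<lambda>b. mon (yprod b)) bs"
  have generates: "ideal_power I k = ideal_gen UNIV (set fs)"
  proof -
    have "yprod ` {b \<in> mons G. mdeg b = k} = yprod ` S"
    proof
      show "yprod ` {b \<in> mons G. mdeg b = k} \<subseteq> yprod ` S"
      proof safe
        fix b assume "b \<in> mons G" "k = mdeg b"
        with ex_standard[OF order \<open>finite G\<close>, of b] show "yprod b \<in> yprod ` S"
          unfolding S_def by (metis (mono_tags, lifting) imageI mem_Collect_eq)
      qed
    qed (use SG in \<open>auto simp: S_def\<close>)
    moreover have "set fs = mon ` yprod ` S" unfolding fs_def using bs(1) by (simp add: image_image)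
    ultimately show ?thesis using ideal_power_monomial[OF I, of k] by simp
  qed
  have "linear_quotients_seq fs"
    unfolding linear_quotients_seq_def
  proof (intro conjI allI impI)
    show "0 \<notin> set fs" unfolding fs_def by (auto dest: arg_cong[of _ _ Poly_Mapping.keys])
    have "homogeneous (d * k) (mon (yprod b) :: ('n, 'k) mpoly)" if "b \<in> S" for b
      using that mdeg_yprod[of G d b, OF d] SG by (auto simp: homogeneous_def S_def)
    \<comment> \<open>All entries have the same degree \<open>d * k\<close>, which is positive by
      \<open>d \<noteq> 0\<close> and \<open>k \<ge> 1\<close>.\<close>
    then show "\<exists>ds. list_all2 homogeneous ds fs \<and> sorted ds \<and> (\<forall>e\<in>set ds. 0 < e)"
      using bs(1) \<open>d \<noteq> 0\<close> \<open>k \<ge> 1\<close>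
      by (intro exI[of _ "replicate (length fs) (d * k)"])
        (auto simp: fs_def list_all2_conv_all_nth sorted_replicate)
    fix j assume "1 \<le> j \<and> j < length fs"
    then have j: "j < length bs" by (simp add: fs_def)
    define W where "W = yprod ` set (take j bs)"
    have bj: "bs ! j \<in> S" using j bs(1) by auto
    \<comment> \<open>Sortedness translates position in the list into the order \<open>lt\<close>,
      in which the exchange property is stated.\<close>
    have before: "b \<in> set (take j bs) \<longleftrightarrow> b \<in> S \<and> lt b (bs ! j)" for b
    proof
      assume "b \<in> set (take j bs)"
      then obtain i where "i < j" "b = bs ! i" using j by (auto simp: in_set_conv_nth)
      then show "b \<in> S \<and> lt b (bs ! j)"
        using bs j by (auto simp: sorted_wrt_iff_nth_less)
    next
      assume b: "b \<in> S \<and> lt b (bs ! j)"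
      then obtain i where i: "i < length bs" "bs ! i = b" using bs(1) by (metis in_set_conv_nth)
      have "i < j"
      proof (rule ccontr)
        assume "\<not> i < j"
        then have "b = bs ! j \<or> lt (bs ! j) b"
          using i bs(2) by (metis linorder_neqE_nat sorted_wrt_iff_nth_less)
        with b bj SG irrefl trans show False
          by (metis (no_types, lifting) irreflp_onD transp_onD subsetD)
      qed
      then show "b \<in> set (take j bs)" using i j by (auto simp: in_set_conv_nth)
    qed
    have exchange: "\<exists>l\<in>Poly_Mapping.keys m. \<exists>v\<in>W. \<exists>e. Poly_Mapping.single l 1 + yprod (bs ! j) = v + e"
      if u: "u \<in> W" and m: "m + yprod (bs ! j) = u + c" for m u c
    proof -
      from u obtain b' where b': "b' \<in> S" "lt b' (bs ! j)" "u = yprod b'"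
        unfolding W_def using before by blast
      from b' bj have "mdeg b' = mdeg (bs ! j)" "standard G lt (bs ! j)" "b' \<in> mons G"
        using SG by (auto simp: S_def)
      from x_condition_exchange[OF assms(5,6), of d "bs ! j" b' m c] this b' m d
      obtain l a e where l: "l \<in> Poly_Mapping.keys m" and a: "a \<in> mons G" "mdeg a = mdeg (bs ! j)"
        "lt a (bs ! j)" and e: "Poly_Mapping.single l 1 + yprod (bs ! j) = yprod a + e"
        unfolding G_def by (auto simp: add.commute)
      \<comment> \<open>The monomial \<open>a\<close> may lie outside \<open>S\<close>. Its standard
        representative \<open>s\<close> has the same product and is still below
        \<open>bs ! j\<close>, so that product belongs to an earlier generator.\<close>
      from ex_standard[OF order \<open>finite G\<close> a(1)] obtain s where s: "standard G lt s"
        "mdeg s = mdeg a" "yprod s = yprod a" "s = a \<or> lt s a" by blast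
      have "s \<in> S" using s(1,2) a(2) bj by (simp add: S_def)
      moreover have "lt s (bs ! j)"
        using s(4) a \<open>s \<in> S\<close> bj SG trans by (metis transp_onD subsetD)
      ultimately have "yprod a \<in> W" unfolding W_def using before s(3) by (metis imageI)
      with l e show ?thesis by blast
    qed
    have fs_take: "set (take j fs) = mon ` W" "fs ! j = mon (yprod (bs ! j))"
      using j by (auto simp: fs_def W_def take_map image_image)
    show "\<exists>L. (\<forall>l\<in>L. homogeneous 1 l) \<and>
        colon (ideal_gen UNIV (set (take j fs))) (fs ! j) = ideal_gen UNIV L"
      unfolding fs_take
    proof (intro exI conjI)
      let ?L = "mon ` {Poly_Mapping.single l 1 | l.
        \<exists>v\<in>W. \<exists>e. Poly_Mapping.single l 1 + yprod (bs ! j) = v + e} :: ('n, 'k) mpoly set"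
      show "colon (ideal_gen UNIV (mon ` W)) (mon (yprod (bs ! j))) = ideal_gen UNIV ?L"
        by (rule colon_mon_eq_variables) (rule exchange)
      show "\<forall>l\<in>?L. homogeneous 1 l" by (auto simp: homogeneous_def)
    qed
  qed
  with generates show ?thesis unfolding has_linear_quotients_def by blast
qed

end
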